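(* Let $V$ be a value quantale and let $X$ be a $V$-space with uniformly vanishing asymmetry. Let $\hat{X}$ be the set of all proper minimal Cauchy filters on $X$, equipped with the distance function $d(\mathcal{F},\mathcal{G})=\bigvee_{F\in\mathcal{F},\,G\in\mathcal{G}}\ \bigwedge_{s\in F,\,t\in G}d(s,t)$. Then the $V$-space $\hat{X}$ is Cauchy complete.
   Context: A value quantale is a pair $(V,+)$ where $V$ is a complete lattice with bottom $0$ and top $\infty$, and $+$ is an associative commutative binary operation on $V$ such that $x+0=x$, $x=\bigwedge\{y\in V\mid y\succ x\}$, $x+\bigwedge S=\bigwedge\{x+s\mid s\in S\}$, and $a\wedge b\succ 0$ whenever $a\succ0$ and $b\succ0$ (for all $x,a,b\in V$, $S\subseteq V$). Here $a\succ b$ ("$a$ is well above $b$") means: for every $S\subseteq V$ with $b\ge\bigwedge S$ there is $s\in S$ with $a\ge s$. Writing "$\varepsilon\succ0$" presumes $\varepsilon\in V$. A $V$-space is a set $X$ with a function $d:X\times X\to V$ with $d(x,x)=0$ and $d(x,z)\le d(x,y)+d(y,z)$ for all $x,y,z\in X$. It has uniformly vanishing asymmetry if for all $\varepsilon\succ0$ there is $\delta\succ0$ such that $d(y,x)\le\delta$ implies $d(x,y)\le\varepsilon$, for all $x,y\in X$. For $\varepsilon\succ0$ put $\mathbf{B}_{\varepsilon}(x)=\{y\in X\mid d(x,y)\le\varepsilon\}$. A filter on $X$ is a non-empty collection $\mathcal{F}\subseteq\mathcal{P}(X)$ closed under supersets and binary intersections; $\emptyset\in\mathcal{F}$ is allowed,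 and $\mathcal{F}$ is proper if $\mathcal{F}\neq\mathcal{P}(X)$. A filter $\mathcal{F}$ is Cauchy if for all $\varepsilon\succ0$ there is $x\in X$ with $\mathbf{B}_{\varepsilon}(x)\in\mathcal{F}$. A minimal Cauchy filter is a Cauchy filter that does not strictly contain another Cauchy filter. A filter $\mathcal{F}$ converges to $x$ if $\mathbf{B}_{\varepsilon}(x)\in\mathcal{F}$ for all $\varepsilon\succ0$. A $V$-space is Cauchy complete if every proper Cauchy filter on it converges to some point. *)

theory Defs
  imports Complex_Main
begin

definition (in complete_lattice) well_above :: "'a \<Rightarrow> 'a \<Rightarrow> bool"  (infix "\<succ>" 50)
  where "a \<succ> b \<longleftrightarrow> (\<forall>S. Inf S \<le> b \<longrightarrow> (\<exists>s\<in>S. s \<le> a))"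

notation well_above (infix "\<succ>" 50)

class value_quantale = complete_lattice + comm_monoid_add +
  assumes zero_eq_bot: "0 = bot"
    and eq_Inf_well_above: "x = Inf {y. y \<succ> x}"
    and add_Inf: "x + Inf S = Inf ((\<lambda>s. x + s) ` S)"
    and inf_well_above_zero: "a \<succ> 0 \<Longrightarrow> b \<succ> 0 \<Longrightarrow> inf a b \<succ> 0"

text \<open>A space is given by a carrier set, which may be empty; the distance is only
  constrained on the carrier.\<close>

locale V_space =
  fixes X :: "'a set" and d :: "'a \<Rightarrow> 'a \<Rightarrow> 'v::value_quantale"
  assumes dist_self: "x \<in> X \<Longrightarrow> d x x = 0"
    and dist_triangle: "x \<in> X \<Longrightarrow> y \<in> X \<Longrightarrow> z \<in> X \<Longrightarrow> d x z \<le> d x y + d y z"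

definition uniformly_vanishing_asymmetry ::
    "'a set \<Rightarrow> ('a \<Rightarrow> 'a \<Rightarrow> 'v::value_quantale) \<Rightarrow> bool"
  where "uniformly_vanishing_asymmetry X d \<longleftrightarrow>
    (\<forall>\<epsilon>. \<epsilon> \<succ> 0 \<longrightarrow> (\<exists>\<delta>. \<delta> \<succ> 0 \<and> (\<forall>x\<in>X. \<forall>y\<in>X. d y x \<le> \<delta> \<longrightarrow> d x y \<le> \<epsilon>)))"

definition V_ball :: "'a set \<Rightarrow> ('a \<Rightarrow> 'a \<Rightarrow> 'v::value_quantale) \<Rightarrow> 'v \<Rightarrow> 'a \<Rightarrow> 'a set"
  where "V_ball X d \<epsilon> x = {y \<in> X. d x y \<le> \<epsilon>}"

text \<open>A filter on the set \<open>X\<close> is a library filter \<open>F\<close> with \<open>F \<le> principal X\<close>; it is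
  determined by the collection \<open>filter_sets X F\<close> of its member sets inside \<open>X\<close>. The
  improper filter \<open>Pow X\<close> is \<open>bot\<close>. The library orders filters by reverse inclusion,
  so inclusions of filters are written in terms of \<open>filter_sets\<close>.\<close>

definition filter_sets :: "'a set \<Rightarrow> 'a filter \<Rightarrow> 'a set set"
  where "filter_sets X F = {A. A \<subseteq> X \<and> eventually (\<lambda>x. x \<in> A) F}"

lemma bij_betw_filter_sets:
  "bij_betw (filter_sets X) {F. F \<le> principal X}
    {S. S \<noteq> {} \<and> S \<subseteq> Pow X \<and> (\<forall>A\<in>S. \<forall>B. A \<subseteq> B \<and> B \<subseteq> X \<longrightarrow> B \<in> S) \<and>
        (\<forall>A\<in>S. \<forall>B\<in>S. A \<inter> B \<in> S)}"
  (is "bij_betw _ ?L ?R")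
proof (rule bij_betw_imageI)
  have ev: "eventually P F \<longleftrightarrow> {x \<in> X. P x} \<in> filter_sets X F" if "F \<le> principal X" for P F
  proof -
    have "eventually (\<lambda>x. x \<in> X) F"
      using that by (simp add: le_principal)
    then show ?thesis
      by (auto simp: filter_sets_def eventually_conj_iff)
  qed
  show "inj_on (filter_sets X) ?L"
  proof (rule inj_onI)
    fix F G assume "F \<in> ?L" "G \<in> ?L" "filter_sets X F = filter_sets X G"
    then show "F = G"
      using ev[of F] ev[of G] by (simp add: filter_eq_iff)
  qed
  show "filter_sets X ` ?L = ?R"
  proof (rule equalityI)
    show "filter_sets X ` ?L \<subseteq> ?R"
    proof (rule image_subsetI)
      fix F assume "F \<in> ?L"
      then have "X \<in> filter_sets X F"
        by (simp add: filter_sets_def le_principal)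
      then show "filter_sets X F \<in> ?R"
        by (auto simp: filter_sets_def eventually_conj_iff elim: eventually_mono)
    qed
    show "?R \<subseteq> filter_sets X ` ?L"
    proof
      fix S assume S: "S \<in> ?R"
      then have up: "\<And>A B. A \<in> S \<Longrightarrow> A \<subseteq> B \<Longrightarrow> B \<subseteq> X \<Longrightarrow> B \<in> S"
        and int: "\<And>A B. A \<in> S \<Longrightarrow> B \<in> S \<Longrightarrow> A \<inter> B \<in> S"
        and sub: "S \<subseteq> Pow X" and ne: "S \<noteq> {}"
        by simp_all
      from ne sub obtain A0 where "A0 \<in> S" "A0 \<subseteq> X"
        by blast
      then have X: "X \<in> S"
        using up by blast
      have "is_filter (\<lambda>P. {x \<in> X. P x} \<in> S)"
      proof
        show "{x \<in> X. True} \<in> S"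
          using X by simp
      next
        fix P Q assume "{x \<in> X. P x} \<in> S" "{x \<in> X. Q x} \<in> S"
        then have "{x \<in> X. P x} \<inter> {x \<in> X. Q x} \<in> S"
          by (rule int)
        moreover have "{x \<in> X. P x} \<inter> {x \<in> X. Q x} = {x \<in> X. P x \<and> Q x}"
          by blast
        ultimately show "{x \<in> X. P x \<and> Q x} \<in> S"
          by simp
      next
        fix P Q assume "\<forall>x. P x \<longrightarrow> Q x" and P: "{x \<in> X. P x} \<in> S"
        then have "{x \<in> X. P x} \<subseteq> {x \<in> X. Q x}"
          by blast
        then show "{x \<in> X. Q x} \<in> S"
          by (rule up[OF P]) simp
      qed
      then have E: "eventually P (Abs_filter (\<lambda>P. {x \<in> X. P x} \<in> S)) \<longleftrightarrow> {x \<in> X. P x} \<in> S" for P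
        by (rule eventually_Abs_filter)
      have XA: "{x \<in> X. x \<in> A} = A" if "A \<subseteq> X" for A
        using that by blast
      have "filter_sets X (Abs_filter (\<lambda>P. {x \<in> X. P x} \<in> S)) = S"
      proof (rule set_eqI)
        fix A
        show "A \<in> filter_sets X (Abs_filter (\<lambda>P. {x \<in> X. P x} \<in> S)) \<longleftrightarrow> A \<in> S"
        proof (cases "A \<subseteq> X")
          case True
          then show ?thesis
            unfolding filter_sets_def mem_Collect_eq E XA[OF True] by blast
        next
          case False
          then show ?thesis
            using sub unfolding filter_sets_def by blast
        qed
      qed
      moreover have "Abs_filter (\<lambda>P. {x \<in> X. P x} \<in> S) \<le> principal X"
        using X by (simp add: le_principal E)
      ultimately show "S \<in> filter_sets X ` ?L"
        by (intro image_eqI[of _ _ "Abs_filter (\<lambda>P. {x \<in> X. P x} \<in> S)"]) simp_all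
    qed
  qed
qed

lemma filter_sets_eq_Pow_iff:
  assumes "F \<le> principal X"
  shows "filter_sets X F = Pow X \<longleftrightarrow> F = bot"
proof
  assume "filter_sets X F = Pow X"
  then have "{} \<in> filter_sets X F"
    by simp
  then show "F = bot"
    by (simp add: filter_sets_def trivial_limit_def)
qed (auto simp: filter_sets_def)

definition Cauchy_filter_on ::
    "'a set \<Rightarrow> ('a \<Rightarrow> 'a \<Rightarrow> 'v::value_quantale) \<Rightarrow> 'a filter \<Rightarrow> bool"
  where "Cauchy_filter_on X d F \<longleftrightarrow>
    F \<le> principal X \<and> (\<forall>\<epsilon>. \<epsilon> \<succ> 0 \<longrightarrow> (\<exists>x\<in>X. V_ball X d \<epsilon> x \<in> filter_sets X F))"

definition minimal_Cauchy_filter_on ::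
    "'a set \<Rightarrow> ('a \<Rightarrow> 'a \<Rightarrow> 'v::value_quantale) \<Rightarrow> 'a filter \<Rightarrow> bool"
  where "minimal_Cauchy_filter_on X d F \<longleftrightarrow>
    Cauchy_filter_on X d F \<and>
    \<not> (\<exists>G. Cauchy_filter_on X d G \<and> filter_sets X G \<subset> filter_sets X F)"

definition V_converges ::
    "'a set \<Rightarrow> ('a \<Rightarrow> 'a \<Rightarrow> 'v::value_quantale) \<Rightarrow> 'a filter \<Rightarrow> 'a \<Rightarrow> bool"
  where "V_converges X d F x \<longleftrightarrow> (\<forall>\<epsilon>. \<epsilon> \<succ> 0 \<longrightarrow> V_ball X d \<epsilon> x \<in> filter_sets X F)"

definition Cauchy_complete :: "'a set \<Rightarrow> ('a \<Rightarrow> 'a \<Rightarrow> 'v::value_quantale) \<Rightarrow> bool"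
  where "Cauchy_complete X d \<longleftrightarrow>
    (\<forall>F. Cauchy_filter_on X d F \<and> F \<noteq> bot \<longrightarrow> (\<exists>x\<in>X. V_converges X d F x))"

definition completion :: "'a set \<Rightarrow> ('a \<Rightarrow> 'a \<Rightarrow> 'v::value_quantale) \<Rightarrow> 'a filter set"
  where "completion X d = {F. minimal_Cauchy_filter_on X d F \<and> F \<noteq> bot}"

definition completion_dist ::
    "'a set \<Rightarrow> ('a \<Rightarrow> 'a \<Rightarrow> 'v::value_quantale) \<Rightarrow> 'a filter \<Rightarrow> 'a filter \<Rightarrow> 'v"
  where "completion_dist X d F G =
    (SUP (A, B) \<in> filter_sets X F \<times> filter_sets X G. INF (s, t) \<in> A \<times> B. d s t)"

end

theory Submission
  imports Defs
begin

text \<open>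
  The radii \<open>\<epsilon> \<succ> 0\<close> of a value quantale can be halved and are arbitrarily small, so they serve
  as the positive reals do for metric spaces; vanishing asymmetry makes the order of the arguments
  of the distance irrelevant up to a change of radius. In particular a Cauchy filter has members
  of arbitrarily small diameter, and this gives the triangle inequality on the completion: a
  small set in the middle filter bridges the gap between its two chosen points.

  For completeness, let \<open>\<Phi>\<close> be a proper Cauchy filter on the completion. The sets that belong to
  \<open>\<Phi>\<close>-almost all minimal Cauchy filters form a filter \<open>K\<close> on \<open>X\<close>. It is Cauchy
  because the members of a small ball of filters all contain a common small ball of \<open>X\<close>
  (\<open>ball_in_nearby_filter\<close>). A minimal Cauchy filter \<open>G\<close> contained in \<open>K\<close>
  (\<open>ex_minimal_Cauchy_filter\<close>) is the limit of \<open>\<Phi>\<close>: a small ball in \<open>K\<close> lies in \<open>\<Phi>\<close>-almost every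
  filter, and two filters that share a small ball are close. Passing from \<open>K\<close> to \<open>G\<close> does no harm,
  as the distance is a supremum over member sets and hence decreases with the filter.
\<close>

section \<open>Positive radii in a value quantale\<close>

lemma well_above_mono: "a \<succ> (b::'v::complete_lattice) \<Longrightarrow> a \<le> a' \<Longrightarrow> a' \<succ> b"
  unfolding well_above_def by (meson order_trans)

lemma value_quantale_add_left_mono:
  fixes a x y :: "'v::value_quantale"
  assumes "x \<le> y"
  shows "a + x \<le> a + y"
proof -
  have "a + x = a + Inf {x, y}"
    using assms by (simp add: inf.absorb1)
  also have "\<dots> \<le> a + y"
    unfolding add_Inf by (rule Inf_lower) simp
  finally show ?thesis .
qed

lemma zero_le_value_quantale: "0 \<le> (x::'v::value_quantale)"
  by (simp add: zero_eq_bot)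

lemma value_quantale_add_mono:
  fixes a b x y :: "'v::value_quantale"
  assumes "a \<le> b" "x \<le> y"
  shows "a + x \<le> b + y"
  using value_quantale_add_left_mono[OF assms(1), of x]
    value_quantale_add_left_mono[OF assms(2), of b]
  by (metis add.commute order_trans)

lemma le_add_Inf:
  fixes b c :: "'v::value_quantale"
  shows "(\<And>x. x \<in> S \<Longrightarrow> c \<le> b + x) \<Longrightarrow> c \<le> b + Inf S"
  unfolding add_Inf by (rule INF_greatest)

lemma Inf_positive: "Inf {\<epsilon>. \<epsilon> \<succ> 0} = (0::'v::value_quantale)"
  using eq_Inf_well_above[of "0::'v"] by simp

lemma le_of_le_add_positive:
  fixes a b :: "'v::value_quantale"
  assumes "\<And>\<epsilon>. \<epsilon> \<succ> 0 \<Longrightarrow> a \<le> b + \<epsilon>"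
  shows "a \<le> b"
  using le_add_Inf[of "{\<epsilon>. \<epsilon> \<succ> 0}" a b] assms by (simp add: Inf_positive)

text \<open>All sums of two positive elements have infimum \<open>0 + 0 = 0\<close>, so one of them lies below
  \<open>\<epsilon>\<close>; the meet of its two summands is again positive.\<close>

lemma positive_half:
  fixes \<epsilon> :: "'v::value_quantale"
  assumes "\<epsilon> \<succ> 0"
  obtains \<delta> where "\<delta> \<succ> 0" "\<delta> + \<delta> \<le> \<epsilon>"
proof -
  define S where "S = {a + b |a b. a \<succ> (0::'v) \<and> b \<succ> 0}"
  have "Inf S \<le> 0 + b" if "b \<succ> 0" for b
  proof -
    have "Inf S \<le> b + a" if "a \<succ> 0" for a
      using that \<open>b \<succ> 0\<close> unfolding S_def by (intro Inf_lower) blast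
    then show ?thesis
      by (simp add: le_of_le_add_positive)
  qed
  then have "Inf S \<le> 0"
    by (rule le_of_le_add_positive)
  then obtain a b where ab: "a \<succ> 0" "b \<succ> 0" "a + b \<le> \<epsilon>"
    using assms unfolding well_above_def[of \<epsilon>] S_def by blast
  have "inf a b + inf a b \<le> a + b"
    by (intro value_quantale_add_mono) auto
  also note ab(3)
  finally show ?thesis
    using ab by (intro that[of "inf a b"] inf_well_above_zero)
qed

lemma positive_third:
  fixes \<epsilon> :: "'v::value_quantale"
  assumes "\<epsilon> \<succ> 0"
  obtains \<delta> where "\<delta> \<succ> 0" "\<delta> + \<delta> + \<delta> \<le> \<epsilon>"
proof -
  obtain a where a: "a \<succ> 0" "a + a \<le> \<epsilon>"
    using assms by (rule positive_half)
  obtain b where b: "b \<succ> 0" "b + b \<le> a"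
    using a(1) by (rule positive_half)
  let ?c = "inf a b"
  have "?c + ?c + ?c \<le> b + b + a"
    by (intro value_quantale_add_mono) auto
  also have "\<dots> \<le> a + a"
    by (intro value_quantale_add_mono b) auto
  also have "\<dots> \<le> \<epsilon>"
    by (rule a)
  finally show ?thesis
    using a b by (intro that[of ?c] inf_well_above_zero)
qed

text \<open>An infimum of distances that is at most \<open>\<delta>\<close> need not be attained, but some distance is at most
  any \<open>\<epsilon> \<succ> \<delta>\<close>. Such a positive \<open>\<delta>\<close> exists because the elements well above some positive element
  still have infimum \<open>0\<close>.\<close>

lemma positive_interpolate:
  fixes \<epsilon> :: "'v::value_quantale"
  assumes "\<epsilon> \<succ> 0"
  obtains \<delta> where "\<delta> \<succ> 0" "\<epsilon> \<succ> \<delta>"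
proof -
  define S where "S = {y. \<exists>z::'v. y \<succ> z \<and> z \<succ> 0}"
  have "Inf S \<le> z" if "z \<succ> 0" for z
    by (subst eq_Inf_well_above[of z], rule Inf_superset_mono) (use that in \<open>auto simp: S_def\<close>)
  then have "Inf S \<le> 0"
    by (metis Inf_greatest Inf_positive mem_Collect_eq)
  then obtain y z where "y \<succ> z" "z \<succ> 0" "y \<le> \<epsilon>"
    using assms unfolding well_above_def[of \<epsilon>] S_def by blast
  then show ?thesis
    using that well_above_mono by blast
qed

section \<open>Cauchy filters and their distance\<close>

lemma filter_sets_subset_iff:
  assumes "G \<le> principal X"
  shows "filter_sets X G \<subseteq> filter_sets X F \<longleftrightarrow> F \<le> G"
proof
  assume sub: "filter_sets X G \<subseteq> filter_sets X F"
  show "F \<le> G"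
  proof (rule filter_leI)
    fix P assume "eventually P G"
    then have "{x \<in> X. P x} \<in> filter_sets X G"
      using assms by (auto simp: filter_sets_def le_principal eventually_conj_iff)
    with sub have "{x \<in> X. P x} \<in> filter_sets X F" ..
    then show "eventually P F"
      by (auto simp: filter_sets_def elim: eventually_mono)
  qed
qed (auto simp: filter_sets_def filter_leD)

lemma filter_sets_Int:
  "A \<in> filter_sets X F \<Longrightarrow> B \<in> filter_sets X F \<Longrightarrow> A \<inter> B \<in> filter_sets X F"
  by (auto simp: filter_sets_def eventually_conj_iff)

lemma filter_sets_superset:
  "A \<in> filter_sets X F \<Longrightarrow> A \<subseteq> B \<Longrightarrow> B \<subseteq> X \<Longrightarrow> B \<in> filter_sets X F"
  by (auto simp: filter_sets_def elim: eventually_mono)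

lemma filter_sets_nonempty:
  "F \<noteq> bot \<Longrightarrow> A \<in> filter_sets X F \<Longrightarrow> A \<noteq> {}"
  by (auto simp: filter_sets_def trivial_limit_def)

lemma filter_sets_Int_nonempty:
  "F \<noteq> bot \<Longrightarrow> A \<in> filter_sets X F \<Longrightarrow> B \<in> filter_sets X F \<Longrightarrow> \<exists>x. x \<in> A \<and> x \<in> B"
  using filter_sets_nonempty[OF _ filter_sets_Int] by fastforce

lemma Cauchy_filter_onD:
  assumes "Cauchy_filter_on X d F" "\<epsilon> \<succ> 0"
  obtains x where "x \<in> X" "V_ball X d \<epsilon> x \<in> filter_sets X F"
  using assms by (auto simp: Cauchy_filter_on_def)

lemma V_ball_subset: "V_ball X d \<epsilon> x \<subseteq> X"
  by (auto simp: V_ball_def)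

lemma Inf_le_completion_dist:
  assumes "A \<in> filter_sets X F" "B \<in> filter_sets X G"
  shows "(INF (s, t) \<in> A \<times> B. d s t) \<le> completion_dist X d F G"
  using assms unfolding completion_dist_def
  by (intro SUP_upper2[of "(A, B)"]) auto

lemma completion_dist_leI:
  assumes "\<And>A B. A \<in> filter_sets X F \<Longrightarrow> B \<in> filter_sets X G \<Longrightarrow>
    (INF (s, t) \<in> A \<times> B. d s t) \<le> e"
  shows "completion_dist X d F G \<le> e"
  using assms unfolding completion_dist_def by (intro SUP_least) auto

lemma completion_dist_leI_witness:
  assumes "\<And>A B. A \<in> filter_sets X F \<Longrightarrow> B \<in> filter_sets X G \<Longrightarrow> \<exists>s\<in>A. \<exists>t\<in>B. d s t \<le> e"
  shows "completion_dist X d F G \<le> e"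
proof (rule completion_dist_leI)
  fix A B assume "A \<in> filter_sets X F" "B \<in> filter_sets X G"
  then obtain s t where "s \<in> A" "t \<in> B" "d s t \<le> e"
    using assms by blast
  then show "(INF (s, t) \<in> A \<times> B. d s t) \<le> e"
    by (intro INF_lower2[of "(s, t)"]) auto
qed

lemma completion_distD_witness:
  assumes "completion_dist X d F G \<le> \<delta>" "\<epsilon> \<succ> \<delta>"
    and "A \<in> filter_sets X F" "B \<in> filter_sets X G"
  obtains s t where "s \<in> A" "t \<in> B" "d s t \<le> \<epsilon>"
proof -
  have "(INF (s, t) \<in> A \<times> B. d s t) \<le> \<delta>"
    using Inf_le_completion_dist[OF assms(3,4)] assms(1) by (rule order_trans)
  then show ?thesis
    using assms(2) that unfolding well_above_def by fastforce
qed

locale V_space_vanishing_asymmetry = V_space X d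
  for X :: "'a set" and d :: "'a \<Rightarrow> 'a \<Rightarrow> 'v::value_quantale" +
  assumes vanishing: "uniformly_vanishing_asymmetry X d"
begin

lemma dist_triangle_le:
  assumes "x \<in> X" "y \<in> X" "z \<in> X" "d x y \<le> a" "d y z \<le> b"
  shows "d x z \<le> a + b"
  using dist_triangle[OF assms(1-3)] value_quantale_add_mono[OF assms(4,5)] by (rule order_trans)

lemma small_reverse:
  assumes "\<epsilon> \<succ> 0"
  obtains \<delta> where "\<delta> \<succ> 0" "\<delta> \<le> \<epsilon>" "\<And>x y. x \<in> X \<Longrightarrow> y \<in> X \<Longrightarrow> d y x \<le> \<delta> \<Longrightarrow> d x y \<le> \<epsilon>"
proof -
  obtain \<delta> where \<delta>: "\<delta> \<succ> 0" "\<And>x y. x \<in> X \<Longrightarrow> y \<in> X \<Longrightarrow> d y x \<le> \<delta> \<Longrightarrow> d x y \<le> \<epsilon>"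
    using vanishing assms unfolding uniformly_vanishing_asymmetry_def by blast
  then show ?thesis
    using assms by (intro that[of "inf \<delta> \<epsilon>"] inf_well_above_zero) auto
qed

text \<open>Two points of a ball are compared through its centre; one of the two legs runs towards the
  centre, which is where vanishing asymmetry enters.\<close>

lemma small_ball_diameter:
  assumes "\<epsilon> \<succ> 0"
  obtains \<delta> where "\<delta> \<succ> 0" "\<delta> \<le> \<epsilon>"
    "\<And>x s t. x \<in> X \<Longrightarrow> s \<in> V_ball X d \<delta> x \<Longrightarrow> t \<in> V_ball X d \<delta> x \<Longrightarrow> d s t \<le> \<epsilon>"
proof -
  obtain \<gamma> where \<gamma>: "\<gamma> \<succ> 0" "\<gamma> + \<gamma> \<le> \<epsilon>"
    using assms by (rule positive_half)
  obtain \<delta> where \<delta>: "\<delta> \<succ> 0" "\<delta> \<le> \<gamma>" "\<And>x y. x \<in> X \<Longrightarrow> y \<in> X \<Longrightarrow> d y x \<le> \<delta> \<Longrightarrow> d x y \<le> \<gamma>"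
    using small_reverse[OF \<gamma>(1)] by blast
  have "d s t \<le> \<epsilon>" if "x \<in> X" "s \<in> V_ball X d \<delta> x" "t \<in> V_ball X d \<delta> x" for x s t
  proof -
    have "s \<in> X" "t \<in> X" "d s x \<le> \<gamma>" "d x t \<le> \<gamma>"
      using that by (auto simp: V_ball_def intro: \<delta>(3) order_trans[OF _ \<delta>(2)])
    then show ?thesis
      using dist_triangle_le[of s x t \<gamma> \<gamma>] that(1) by (auto intro: order_trans[OF _ \<gamma>(2)])
  qed
  moreover have "\<gamma> \<le> \<epsilon>"
    using order_trans[OF value_quantale_add_left_mono[of 0 \<gamma> \<gamma>] \<gamma>(2)]
    by (simp add: zero_le_value_quantale)
  ultimately show ?thesis
    using \<delta>(1) order_trans[OF \<delta>(2)] by (intro that[of \<delta>]) auto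
qed

lemma Cauchy_small_set:
  assumes "Cauchy_filter_on X d F" "\<epsilon> \<succ> 0"
  obtains A where "A \<in> filter_sets X F" "\<And>s t. s \<in> A \<Longrightarrow> t \<in> A \<Longrightarrow> d s t \<le> \<epsilon>"
proof -
  obtain \<delta> where \<delta>: "\<delta> \<succ> 0" "\<delta> \<le> \<epsilon>"
    "\<And>x s t. x \<in> X \<Longrightarrow> s \<in> V_ball X d \<delta> x \<Longrightarrow> t \<in> V_ball X d \<delta> x \<Longrightarrow> d s t \<le> \<epsilon>"
    using small_ball_diameter[OF assms(2)] by blast
  obtain x where "x \<in> X" "V_ball X d \<delta> x \<in> filter_sets X F"
    using Cauchy_filter_onD[OF assms(1) \<delta>(1)] .
  then show ?thesis
    using \<delta>(3) that by blast
qed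

lemma completion_dist_self:
  assumes "F \<noteq> bot"
  shows "completion_dist X d F F = 0"
proof -
  have "completion_dist X d F F \<le> 0"
  proof (rule completion_dist_leI_witness)
    fix A B assume AB: "A \<in> filter_sets X F" "B \<in> filter_sets X F"
    then obtain x where "x \<in> A" "x \<in> B"
      using filter_sets_Int_nonempty assms by blast
    moreover from this have "x \<in> X"
      using AB by (auto simp: filter_sets_def)
    ultimately show "\<exists>s\<in>A. \<exists>t\<in>B. d s t \<le> 0"
      using dist_self by force
  qed
  then show ?thesis
    by (simp add: zero_eq_bot bot_unique)
qed

text \<open>The two infima on the right are approached at different points of a member \<open>B\<close> of the middle
  filter, at the cost of the diameter \<open>\<epsilon>\<close> of \<open>B\<close>.\<close>

lemma completion_dist_triangle:
  assumes "Cauchy_filter_on X d G"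
  shows "completion_dist X d F H \<le> completion_dist X d F G + completion_dist X d G H"
proof (rule completion_dist_leI, rule le_of_le_add_positive)
  fix A C and \<epsilon> :: 'v
  assume A: "A \<in> filter_sets X F" and C: "C \<in> filter_sets X H" and "\<epsilon> \<succ> 0"
  then obtain B where B: "B \<in> filter_sets X G" "\<And>s t. s \<in> B \<Longrightarrow> t \<in> B \<Longrightarrow> d s t \<le> \<epsilon>"
    using Cauchy_small_set assms by blast
  define AB where "AB = (INF (s, t) \<in> A \<times> B. d s t)"
  define BC where "BC = (INF (s, t) \<in> B \<times> C. d s t)"
  let ?AC = "INF (s, t) \<in> A \<times> C. d s t"
  have point: "?AC \<le> (\<epsilon> + d s t) + d t' u" if "s \<in> A" "t \<in> B" "t' \<in> B" "u \<in> C" for s t t' u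
  proof -
    have "s \<in> X" "t \<in> X" "t' \<in> X" "u \<in> X"
      using that A B(1) C by (auto simp: filter_sets_def)
    moreover from this have "d s t' \<le> d s t + \<epsilon>"
      using dist_triangle_le[of s t t' _ \<epsilon>] B(2) that by blast
    ultimately have "d s u \<le> d s t + \<epsilon> + d t' u"
      using dist_triangle_le by blast
    moreover have "?AC \<le> d s u"
      using that by (intro INF_lower2[of "(s, u)"]) auto
    ultimately show ?thesis
      unfolding add.commute[of \<epsilon>] by (rule order_trans[rotated])
  qed
  have "?AC \<le> (\<epsilon> + d s t) + BC" if "s \<in> A" "t \<in> B" for s t
    unfolding BC_def using point that by (intro le_add_Inf) auto
  then have "?AC \<le> (\<epsilon> + BC) + AB"
    unfolding AB_def by (intro le_add_Inf) (auto simp: ac_simps)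
  also have "\<dots> = AB + BC + \<epsilon>"
    by (simp add: ac_simps)
  also have "\<dots> \<le> completion_dist X d F G + completion_dist X d G H + \<epsilon>"
    unfolding AB_def BC_def using A B(1) C
    by (intro value_quantale_add_mono Inf_le_completion_dist order_refl)
  finally show "?AC \<le> completion_dist X d F G + completion_dist X d G H + \<epsilon>" .
qed

lemma V_space_completion: "V_space (completion X d) (completion_dist X d)"
  by standard (auto simp: completion_def minimal_Cauchy_filter_on_def
      intro: completion_dist_self completion_dist_triangle)

section \<open>Completeness\<close>

text \<open>The intersection of all Cauchy filters contained in \<open>K\<close> is the candidate, and minimality is
  clear if it is Cauchy. It is, since a ball centred at a fixed \<open>x\<close> belongs to all of them: each one
  has a small ball as a member, which meets a small ball around \<open>x\<close> because both belong to \<open>K\<close>. In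
  the order of filters, intersection is the supremum.\<close>

lemma ex_minimal_Cauchy_filter:
  assumes K: "Cauchy_filter_on X d K" "K \<noteq> bot"
  obtains G where "minimal_Cauchy_filter_on X d G" "K \<le> G"
proof -
  define \<C> where "\<C> = {F. Cauchy_filter_on X d F \<and> K \<le> F}"
  define G where "G = Sup \<C>"
  have "K \<le> G"
    unfolding G_def \<C>_def using K by (intro Sup_upper) auto
  have "G \<le> principal X"
    unfolding G_def \<C>_def by (intro Sup_least) (auto simp: Cauchy_filter_on_def)
  moreover have "\<exists>x\<in>X. V_ball X d \<epsilon> x \<in> filter_sets X G" if "\<epsilon> \<succ> 0" for \<epsilon>
  proof -
    obtain \<gamma> where \<gamma>: "\<gamma> \<succ> 0" "\<gamma> + \<gamma> \<le> \<epsilon>"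
      using \<open>\<epsilon> \<succ> 0\<close> by (rule positive_half)
    obtain \<delta> where \<delta>: "\<delta> \<succ> 0" "\<delta> \<le> \<gamma>"
      "\<And>x s t. x \<in> X \<Longrightarrow> s \<in> V_ball X d \<delta> x \<Longrightarrow> t \<in> V_ball X d \<delta> x \<Longrightarrow> d s t \<le> \<gamma>"
      using small_ball_diameter[OF \<gamma>(1)] by blast
    obtain x where x: "x \<in> X" "V_ball X d \<delta> x \<in> filter_sets X K"
      using Cauchy_filter_onD[OF K(1) \<delta>(1)] .
    have "V_ball X d \<epsilon> x \<in> filter_sets X F" if "F \<in> \<C>" for F
    proof -
      from that have "Cauchy_filter_on X d F"
        by (simp add: \<C>_def)
      then obtain y where y: "y \<in> X" "V_ball X d \<delta> y \<in> filter_sets X F"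
        using \<delta>(1) by (rule Cauchy_filter_onD)
      then have "V_ball X d \<delta> y \<in> filter_sets X K"
        using that by (auto simp: \<C>_def filter_sets_def filter_leD)
      then obtain z where z: "z \<in> V_ball X d \<delta> x" "z \<in> V_ball X d \<delta> y"
        using filter_sets_Int_nonempty[OF K(2) x(2)] by blast
      have "w \<in> V_ball X d \<epsilon> x" if w: "w \<in> V_ball X d \<delta> y" for w
      proof -
        have "d x z \<le> \<gamma>" "z \<in> X" "w \<in> X"
          using z w by (auto simp: V_ball_def intro: order_trans[OF _ \<delta>(2)])
        moreover have "d z w \<le> \<gamma>"
          using \<delta>(3)[OF y(1) z(2) w] .
        ultimately have "d x w \<le> \<epsilon>"
          using dist_triangle_le[of x z w \<gamma> \<gamma>] x(1) by (auto intro: order_trans[OF _ \<gamma>(2)])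
        then show ?thesis
          using \<open>w \<in> X\<close> by (simp add: V_ball_def)
      qed
      then show ?thesis
        by (rule filter_sets_superset[OF y(2) subsetI V_ball_subset])
    qed
    then show ?thesis
      using x(1) by (auto simp: G_def filter_sets_def eventually_Sup V_ball_def)
  qed
  ultimately have G: "Cauchy_filter_on X d G"
    by (simp add: Cauchy_filter_on_def)
  have "filter_sets X G \<subseteq> filter_sets X F"
    if F: "Cauchy_filter_on X d F" "filter_sets X F \<subseteq> filter_sets X G" for F
  proof -
    have "G \<le> F"
      using F filter_sets_subset_iff[of F X G] by (simp add: Cauchy_filter_on_def)
    then have "F \<le> G"
      unfolding G_def using F(1) order_trans[OF \<open>K \<le> G\<close> \<open>G \<le> F\<close>]
      by (intro Sup_upper) (simp add: \<C>_def)
    then show ?thesis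
      by (auto simp: filter_sets_def filter_leD)
  qed
  with G have "minimal_Cauchy_filter_on X d G"
    unfolding minimal_Cauchy_filter_on_def by blast
  then show ?thesis
    using \<open>K \<le> G\<close> that by blast
qed

text \<open>The point \<open>x\<close> depends on \<open>F\<close> only. It is taken in a small member \<open>A\<close> of \<open>F\<close>; every nearby
  Cauchy filter \<open>H\<close> has a small member with a point close to \<open>A\<close>, and that member then lies in the
  ball around \<open>x\<close>.\<close>

lemma ball_in_nearby_filter:
  assumes "\<epsilon> \<succ> 0"
  obtains \<delta> where "\<delta> \<succ> 0"
    "\<And>F. Cauchy_filter_on X d F \<Longrightarrow> F \<noteq> bot \<Longrightarrow> \<exists>x\<in>X. \<forall>H. Cauchy_filter_on X d H \<longrightarrow>
       completion_dist X d F H \<le> \<delta> \<longrightarrow> V_ball X d \<epsilon> x \<in> filter_sets X H"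
proof -
  obtain \<gamma> where \<gamma>: "\<gamma> \<succ> 0" "\<gamma> + \<gamma> + \<gamma> \<le> \<epsilon>"
    using assms by (rule positive_third)
  obtain \<delta> where \<delta>: "\<delta> \<succ> 0" "\<gamma> \<succ> \<delta>"
    using \<gamma>(1) by (rule positive_interpolate)
  have *: "\<exists>x\<in>X. \<forall>H. Cauchy_filter_on X d H \<longrightarrow>
      completion_dist X d F H \<le> \<delta> \<longrightarrow> V_ball X d \<epsilon> x \<in> filter_sets X H"
    if F: "Cauchy_filter_on X d F" "F \<noteq> bot" for F
  proof -
    obtain A where A: "A \<in> filter_sets X F" "\<And>s t. s \<in> A \<Longrightarrow> t \<in> A \<Longrightarrow> d s t \<le> \<gamma>"
      using Cauchy_small_set[OF F(1) \<gamma>(1)] by blast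
    then obtain x where x: "x \<in> A" "x \<in> X"
      using filter_sets_nonempty[OF F(2) A(1)] by (auto simp: filter_sets_def)
    have "V_ball X d \<epsilon> x \<in> filter_sets X H"
      if H: "Cauchy_filter_on X d H" "completion_dist X d F H \<le> \<delta>" for H
    proof -
      obtain C where C: "C \<in> filter_sets X H" "\<And>s t. s \<in> C \<Longrightarrow> t \<in> C \<Longrightarrow> d s t \<le> \<gamma>"
        using Cauchy_small_set[OF H(1) \<gamma>(1)] by blast
      obtain s t where st: "s \<in> A" "t \<in> C" "d s t \<le> \<gamma>"
        using completion_distD_witness[OF H(2) \<delta>(2) A(1) C(1)] .
      have "y \<in> V_ball X d \<epsilon> x" if "y \<in> C" for y
      proof -
        have X: "s \<in> X" "t \<in> X" "y \<in> X"
          using st that A(1) C(1) by (auto simp: filter_sets_def)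
        have "d x t \<le> \<gamma> + \<gamma>"
          using dist_triangle_le[of x s t] x X A(2) st by blast
        then have "d x y \<le> \<gamma> + \<gamma> + \<gamma>"
          using dist_triangle_le[of x t y] x X C(2) st that by blast
        then show ?thesis
          using X by (auto simp: V_ball_def intro: order_trans[OF _ \<gamma>(2)])
      qed
      then show ?thesis
        by (rule filter_sets_superset[OF C(1) subsetI V_ball_subset])
    qed
    then show ?thesis
      using x(2) by blast
  qed
  show ?thesis
    by (rule that[OF \<delta>(1) *])
qed

lemma completion_dist_le_common_ball:
  assumes "\<epsilon> \<succ> 0"
  obtains \<delta> where "\<delta> \<succ> 0"
    "\<And>F H x. F \<noteq> bot \<Longrightarrow> H \<noteq> bot \<Longrightarrow> x \<in> X \<Longrightarrow> V_ball X d \<delta> x \<in> filter_sets X F \<Longrightarrow>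
       V_ball X d \<delta> x \<in> filter_sets X H \<Longrightarrow> completion_dist X d F H \<le> \<epsilon>"
proof -
  obtain \<delta> where \<delta>: "\<delta> \<succ> 0" "\<delta> \<le> \<epsilon>"
      "\<And>x s t. x \<in> X \<Longrightarrow> s \<in> V_ball X d \<delta> x \<Longrightarrow> t \<in> V_ball X d \<delta> x \<Longrightarrow> d s t \<le> \<epsilon>"
    using small_ball_diameter[OF assms] by blast
  show ?thesis
  proof (rule that[OF \<delta>(1)], rule completion_dist_leI_witness)
    fix F H x A B
    assume *: "F \<noteq> bot" "H \<noteq> bot" "x \<in> X" "V_ball X d \<delta> x \<in> filter_sets X F"
      "V_ball X d \<delta> x \<in> filter_sets X H" "A \<in> filter_sets X F" "B \<in> filter_sets X H"
    obtain s where "s \<in> A" "s \<in> V_ball X d \<delta> x"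
      using filter_sets_Int_nonempty * by blast
    moreover obtain t where "t \<in> B" "t \<in> V_ball X d \<delta> x"
      using filter_sets_Int_nonempty * by blast
    ultimately show "\<exists>s\<in>A. \<exists>t\<in>B. d s t \<le> \<epsilon>"
      using \<delta>(3)[OF *(3)] by blast
  qed
qed

lemma completion_dist_mono_left:
  assumes "K \<le> G"
  shows "completion_dist X d G H \<le> completion_dist X d K H"
  unfolding completion_dist_def using assms
  by (intro SUP_subset_mono) (auto simp: filter_sets_def filter_leD)

lemma Cauchy_complete_completion: "Cauchy_complete (completion X d) (completion_dist X d)"
  unfolding Cauchy_complete_def
proof (intro allI impI, elim conjE)
  let ?Y = "completion X d" and ?D = "completion_dist X d"
  fix \<Phi> assume \<Phi>: "Cauchy_filter_on ?Y ?D \<Phi>" "\<Phi> \<noteq> bot"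
  have ev_Y: "eventually (\<lambda>H. H \<in> ?Y) \<Phi>"
    using \<Phi>(1) by (simp add: Cauchy_filter_on_def le_principal)
  have Y: "Cauchy_filter_on X d H" "H \<noteq> bot" "H \<le> principal X" if "H \<in> ?Y" for H
    using that by (auto simp: completion_def minimal_Cauchy_filter_on_def Cauchy_filter_on_def)
  define K where "K = Abs_filter (\<lambda>P. eventually (\<lambda>H. eventually P H) \<Phi>)"
  have ev_K: "eventually P K \<longleftrightarrow> eventually (\<lambda>H. eventually P H) \<Phi>" for P
    unfolding K_def
  proof (rule eventually_Abs_filter, rule is_filter.intro)
    fix P Q :: "'a \<Rightarrow> bool"
    show "eventually (\<lambda>H. eventually (\<lambda>x. P x \<and> Q x) H) \<Phi>"
      if "eventually (\<lambda>H. eventually P H) \<Phi>" "eventually (\<lambda>H. eventually Q H) \<Phi>"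
      using that by eventually_elim (rule eventually_conj)
    show "eventually (\<lambda>H. eventually Q H) \<Phi>"
      if "\<forall>x. P x \<longrightarrow> Q x" "eventually (\<lambda>H. eventually P H) \<Phi>"
      using that(2) by eventually_elim (use that(1) in \<open>auto elim: eventually_mono\<close>)
  qed (simp add: always_eventually)
  have sets_K: "A \<in> filter_sets X K \<longleftrightarrow>
      A \<subseteq> X \<and> eventually (\<lambda>H. A \<in> filter_sets X H) \<Phi>" for A
    by (auto simp: filter_sets_def ev_K elim: eventually_mono)
  have "K \<noteq> bot"
  proof
    assume "K = bot"
    then have "eventually (\<lambda>H. H = bot) \<Phi>"
      using ev_K[of "\<lambda>_. False"] by (simp add: trivial_limit_def)
    with ev_Y have "eventually (\<lambda>_. False) \<Phi>"
      by eventually_elim (use Y(2) in auto)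
    then show False
      using \<Phi>(2) by (simp add: trivial_limit_def)
  qed
  have "K \<le> principal X"
    unfolding le_principal ev_K using ev_Y
    by eventually_elim (use Y(3) in \<open>auto simp: le_principal\<close>)
  moreover have "\<exists>x\<in>X. V_ball X d \<epsilon> x \<in> filter_sets X K" if "\<epsilon> \<succ> 0" for \<epsilon>
  proof -
    obtain \<delta> where \<delta>: "\<delta> \<succ> 0"
      "\<And>F. Cauchy_filter_on X d F \<Longrightarrow> F \<noteq> bot \<Longrightarrow> \<exists>x\<in>X. \<forall>H. Cauchy_filter_on X d H \<longrightarrow>
         ?D F H \<le> \<delta> \<longrightarrow> V_ball X d \<epsilon> x \<in> filter_sets X H"
      using ball_in_nearby_filter[OF \<open>\<epsilon> \<succ> 0\<close>] by blast
    obtain F where F: "F \<in> ?Y" "V_ball ?Y ?D \<delta> F \<in> filter_sets ?Y \<Phi>"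
      using Cauchy_filter_onD[OF \<Phi>(1) \<delta>(1)] .
    obtain x where x: "x \<in> X" "\<And>H. Cauchy_filter_on X d H \<Longrightarrow> ?D F H \<le> \<delta> \<Longrightarrow>
        V_ball X d \<epsilon> x \<in> filter_sets X H"
      using \<delta>(2) Y F(1) by blast
    have "eventually (\<lambda>H. H \<in> V_ball ?Y ?D \<delta> F) \<Phi>"
      using F(2) by (simp add: filter_sets_def)
    then have "eventually (\<lambda>H. V_ball X d \<epsilon> x \<in> filter_sets X H) \<Phi>"
      by eventually_elim (use x(2) Y(1) in \<open>auto simp: V_ball_def\<close>)
    then show ?thesis
      using x(1) by (intro bexI[of _ x]) (simp_all add: sets_K V_ball_subset)
  qed
  ultimately have K: "Cauchy_filter_on X d K"
    by (simp add: Cauchy_filter_on_def)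
  obtain G where G: "minimal_Cauchy_filter_on X d G" "K \<le> G"
    using ex_minimal_Cauchy_filter[OF K \<open>K \<noteq> bot\<close>] .
  have "G \<in> ?Y"
    using G \<open>K \<noteq> bot\<close> by (auto simp: completion_def bot_unique)
  moreover have "V_ball ?Y ?D \<epsilon> G \<in> filter_sets ?Y \<Phi>" if "\<epsilon> \<succ> 0" for \<epsilon>
  proof -
    obtain \<delta> where \<delta>: "\<delta> \<succ> 0"
      "\<And>F H x. F \<noteq> bot \<Longrightarrow> H \<noteq> bot \<Longrightarrow> x \<in> X \<Longrightarrow> V_ball X d \<delta> x \<in> filter_sets X F \<Longrightarrow>
         V_ball X d \<delta> x \<in> filter_sets X H \<Longrightarrow> ?D F H \<le> \<epsilon>"
      using completion_dist_le_common_ball[OF \<open>\<epsilon> \<succ> 0\<close>] by blast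
    obtain x where x: "x \<in> X" "V_ball X d \<delta> x \<in> filter_sets X K"
      using Cauchy_filter_onD[OF K \<delta>(1)] .
    then have "eventually (\<lambda>H. V_ball X d \<delta> x \<in> filter_sets X H) \<Phi>"
      by (simp add: sets_K)
    with ev_Y have "eventually (\<lambda>H. H \<in> V_ball ?Y ?D \<epsilon> G) \<Phi>"
    proof eventually_elim
      case (elim H)
      then have "?D K H \<le> \<epsilon>"
        using \<delta>(2) \<open>K \<noteq> bot\<close> Y(2) x by blast
      then show ?case
        using elim(1) order_trans[OF completion_dist_mono_left[OF G(2)]]
        by (auto simp: V_ball_def)
    qed
    then show ?thesis
      by (simp add: filter_sets_def V_ball_subset)
  qed
  ultimately show "\<exists>G\<in>?Y. V_converges ?Y ?D \<Phi> G"
    unfolding V_converges_def by blast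
qed

end

theorem theorem4p21:
  fixes X :: "'a set" and d :: "'a \<Rightarrow> 'a \<Rightarrow> 'v::value_quantale"
  assumes "V_space X d"
    and "uniformly_vanishing_asymmetry X d"
  shows "V_space (completion X d) (completion_dist X d) \<and>
    Cauchy_complete (completion X d) (completion_dist X d)"
proof -
  interpret V_space_vanishing_asymmetry X d
    using assms by (simp add: V_space_vanishing_asymmetry_def V_space_vanishing_asymmetry_axioms_def)
  show ?thesis
    using V_space_completion Cauchy_complete_completion ..
qed

end
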